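(* Let $t\ge 1$ and $i\ge 1$ be integers. There is a bijection between the set of compositions of $(t^2-t)$-Dyck paths of length $2i$ (with any number of segments) equipped with a $t$-feasible coloring on the segments, and the set of sequences of length $i-1$ on an alphabet of $t^2+t$ letters.
   Context: A Dyck path of length $2n$ is a lattice path from $(0,0)$ to $(2n,0)$ with up steps $U=(1,1)$ and down steps $D=(1,-1)$ that never goes below the $x$-axis. For an integer $k\ge 0$, a $k$-Dyck path is a Dyck path in which each up step that is not immediately followed by a down step is colored with one of $k$ colors $\{1,\dots,k\}$ (other up steps are uncolored). A composition of a $k$-Dyck path $P$ is a sequence $(P_1,\dots,P_j)$ ($j\ge1$) of nonempty $k$-Dyck paths with $P=P_1P_2\cdots P_j$ (concatenation); $j$ is the number of segments. Given $t$ colors $c_1,\dots,c_t$, a $t$-feasible coloring of a composition with $j$ segments is an assignment of one of these $t$ colors to each of the $j$ segments such that the color $c_1$ is used at least once. *)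

theory Defs
  imports Main "HOL-Library.Product_Plus"
begin

datatype step = U | D

primrec step_vec :: "step \<Rightarrow> int \<times> int" where
  "step_vec U = (1, 1)"
| "step_vec D = (1, -1)"

definition endpoint :: "step list \<Rightarrow> int \<times> int" where
  "endpoint w = (\<Sum>s\<leftarrow>w. step_vec s)"

text \<open>Lattice paths start at the origin; \<open>dyck_path n w\<close> means that \<open>w\<close> is a Dyck path of
  length \<open>2 * n\<close>.\<close>

definition dyck_path :: "nat \<Rightarrow> step list \<Rightarrow> bool" where
  "dyck_path n w \<longleftrightarrow>
     endpoint w = (2 * int n, 0) \<and> (\<forall>m\<le>length w. 0 \<le> snd (endpoint (take m w)))"

text \<open>\<open>Up None\<close> is an uncolored up step and \<open>Up (Some c)\<close> is an up step of color \<open>c\<close>.\<close>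

datatype cstep = Up "nat option" | Down

primrec uncolor :: "cstep \<Rightarrow> step" where
  "uncolor (Up c) = U"
| "uncolor Down = D"

definition k_dyck_path :: "nat \<Rightarrow> nat \<Rightarrow> cstep list \<Rightarrow> bool" where
  "k_dyck_path k n P \<longleftrightarrow>
     dyck_path n (map uncolor P) \<and>
     (\<forall>p c. p < length P \<and> P ! p = Up c \<longrightarrow>
        (if Suc p < length P \<and> P ! Suc p = Down then c = None else c \<in> Some ` {1..k}))"

definition composition :: "nat \<Rightarrow> cstep list \<Rightarrow> cstep list list \<Rightarrow> bool" where
  "composition k P Ps \<longleftrightarrow>
     Ps \<noteq> [] \<and> (\<forall>Q\<in>set Ps. Q \<noteq> [] \<and> (\<exists>m. k_dyck_path k m Q)) \<and> P = concat Ps"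

text \<open>The color \<open>c\<^sub>r\<close> is represented by the number \<open>r\<close>, so the distinguished color is \<open>1\<close>;
  segment \<open>Ps ! l\<close> receives the color \<open>cs ! l\<close>.\<close>

definition feasible_coloring :: "nat \<Rightarrow> cstep list list \<Rightarrow> nat list \<Rightarrow> bool" where
  "feasible_coloring t Ps cs \<longleftrightarrow> length cs = length Ps \<and> set cs \<subseteq> {1..t} \<and> 1 \<in> set cs"

definition colored_compositions :: "nat \<Rightarrow> nat \<Rightarrow> nat \<Rightarrow> (cstep list list \<times> nat list) set" where
  "colored_compositions k t n =
     {(Ps, cs). (\<exists>P. k_dyck_path k n P \<and> composition k P Ps) \<and> feasible_coloring t Ps cs}"

end

theory Submission
  imports Defs "HOL-Computational_Algebra.Formal_Power_Series"
begin

text \<open>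
  Let \<open>N\<close> be the generating function of nonempty \<open>k\<close>-Dyck paths by length. Cutting a path at its first
  return to the axis gives \<open>N = X\<^sup>2 (1 + N) (1 + k N)\<close>. Sequences of segments colored from a set of \<open>c\<close>
  colors have generating function \<open>A\<^sub>c\<close> with \<open>A\<^sub>c (1 - c N) = 1\<close>, and the feasible colorings are those
  from \<open>{1..t}\<close> that do not only use \<open>{2..t}\<close>, so they are counted by \<open>W = A\<^sub>t - A\<^bsub>t-1\<^esub>\<close>, whence
  \<open>W (1 - t N) (1 - (t - 1) N) = N\<close>. For \<open>k = t (t - 1)\<close> these equations combine to
  \<open>W (1 - (t\<^sup>2 + t) X\<^sup>2) = X\<^sup>2\<close>, a geometric series.
\<close>

unbundle fps_syntax

section \<open>Generating functions of weighted sets\<close>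

definition level :: "('a \<Rightarrow> nat) \<Rightarrow> 'a set \<Rightarrow> nat \<Rightarrow> 'a set" where
  "level f S n = {x \<in> S. f x = n}"

text \<open>Integer coefficients make \<open>1 - gf f S\<close> available. An infinite level would
  get coefficient 0, which is why the sum, product and list rules below assume finite
  levels.\<close>

definition gf :: "('a \<Rightarrow> nat) \<Rightarrow> 'a set \<Rightarrow> int fps" where
  "gf f S = Abs_fps (\<lambda>n. int (card (level f S n)))"

lemma gf_nth [simp]: "gf f S $ n = int (card (level f S n))"
  by (simp add: gf_def)

text \<open>Level \<open>n - c\<close> of \<open>S\<close> is carried onto level \<open>n\<close> of
  \<open>T\<close>, and no element of \<open>T\<close> has weight below \<open>c\<close>. The shift
  accounts for the two steps removed by the first-return decomposition.\<close>

lemma gf_bij_shift: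
  assumes "bij_betw h S T" and shift: "\<And>x. x \<in> S \<Longrightarrow> g (h x) = f x + c"
  shows "gf g T = fps_X ^ c * gf f S"
proof (rule fps_ext)
  fix n
  have inj: "inj_on h S" and img: "h ` S = T"
    using assms(1) by (auto simp: bij_betw_def)
  show "gf g T $ n = (fps_X ^ c * gf f S) $ n"
  proof (cases "n < c")
    case True
    then have "level g T n = {}"
      using img shift by (auto simp: level_def)
    with True show ?thesis
      by (simp add: fps_X_power_mult_nth)
  next
    case False
    then have "level g T n = h ` level f S (n - c)"
      using img shift by (auto simp: level_def)
    moreover have "inj_on h (level f S (n - c))"
      using inj by (rule inj_on_subset) (auto simp: level_def)
    ultimately show ?thesis
      using False by (simp add: fps_X_power_mult_nth card_image)
  qed
qed

lemma gf_bij: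
  assumes "bij_betw h S T" "\<And>x. x \<in> S \<Longrightarrow> g (h x) = f x"
  shows "gf g T = gf f S"
  using gf_bij_shift[of h S T g f 0] assms by simp

lemma gf_Un:
  assumes "\<And>n. finite (level f S n)" "\<And>n. finite (level f T n)" "S \<inter> T = {}"
  shows "gf f (S \<union> T) = gf f S + gf f T"
proof (rule fps_ext)
  fix n
  have "level f (S \<union> T) n = level f S n \<union> level f T n"
    by (auto simp: level_def)
  moreover have "level f S n \<inter> level f T n = {}"
    using assms(3) by (auto simp: level_def)
  ultimately show "gf f (S \<union> T) $ n = (gf f S + gf f T) $ n"
    using assms(1,2) by (simp add: card_Un_disjoint)
qed

lemma gf_weight_zero:
  assumes "\<And>x. x \<in> C \<Longrightarrow> f x = 0"
  shows "gf f C = of_nat (card C)"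
proof (rule fps_ext)
  fix n
  have "level f C n = (if n = 0 then C else {})"
    using assms by (auto simp: level_def)
  then show "gf f C $ n = of_nat (card C) $ n"
    by (simp add: fps_of_nat[symmetric])
qed

lemma gf_Times:
  assumes "\<And>n. finite (level f S n)" "\<And>n. finite (level g T n)"
  shows "gf (\<lambda>(x, y). f x + g y) (S \<times> T) = gf f S * gf g T"
proof (rule fps_ext)
  fix n
  have "level (\<lambda>(x, y). f x + g y) (S \<times> T) n = (\<Union>i\<in>{0..n}. level f S i \<times> level g T (n - i))"
    by (auto simp: level_def)
  moreover have "card (\<Union>i\<in>{0..n}. level f S i \<times> level g T (n - i)) =
      (\<Sum>i\<in>{0..n}. card (level f S i \<times> level g T (n - i)))"
    using assms by (intro card_UN_disjoint) (auto simp: level_def)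
  ultimately show "gf (\<lambda>(x, y). f x + g y) (S \<times> T) $ n = (gf f S * gf g T) $ n"
    by (simp add: fps_mult_nth card_cartesian_product)
qed

lemma finite_level_Times:
  assumes "\<And>n. finite (level f S n)" "\<And>n. finite (level g T n)"
  shows "finite (level (\<lambda>(x, y). f x + g y) (S \<times> T) n)"
proof -
  have "level (\<lambda>(x, y). f x + g y) (S \<times> T) n \<subseteq> (\<Union>i\<in>{0..n}. level f S i \<times> level g T (n - i))"
    by (auto simp: level_def)
  then show ?thesis
    using assms by (auto intro: finite_subset)
qed

text \<open>Positive weights bound the number of entries by the total weight \<open>n\<close>, and
  each entry weighs at most \<open>n\<close>, so the lists are short words over a finite
  alphabet.\<close>

lemma finite_level_lists:
  assumes fin: "\<And>n. finite (level f S n)" and pos: "\<And>x. x \<in> S \<Longrightarrow> 0 < f x"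
  shows "finite (level (\<lambda>xs. \<Sum>x\<leftarrow>xs. f x) (lists S) n)"
proof -
  have len: "length xs \<le> (\<Sum>x\<leftarrow>xs. f x)" if "xs \<in> lists S" for xs
    using that pos by (induction xs) force+
  have "level (\<lambda>xs. \<Sum>x\<leftarrow>xs. f x) (lists S) n
      \<subseteq> {xs. set xs \<subseteq> (\<Union>i\<le>n. level f S i) \<and> length xs \<le> n}"
    using len by (fastforce simp: level_def intro: member_le_sum_list)
  moreover have "finite (\<Union>i\<le>n. level f S i)"
    using fin by simp
  ultimately show ?thesis
    using finite_lists_length_le[of "\<Union>i\<le>n. level f S i" n] by (blast intro: finite_subset)
qed

text \<open>A list is empty or a head followed by a list, so its series \<open>L\<close> satisfies
  \<open>L = 1 + F * L\<close> with \<open>F = gf f S\<close>. The product form avoids inverting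
  series over the integers.\<close>

lemma gf_lists:
  assumes fin: "\<And>n. finite (level f S n)" and pos: "\<And>x. x \<in> S \<Longrightarrow> 0 < f x"
  shows "gf (\<lambda>xs. \<Sum>x\<leftarrow>xs. f x) (lists S) * (1 - gf f S) = 1"
proof -
  let ?w = "\<lambda>xs. \<Sum>x\<leftarrow>xs. f x"
  have split: "lists S = {[]} \<union> (lists S - {[]})"
    by auto
  have finl: "finite (level ?w (lists S) n)" for n
    using fin pos by (rule finite_level_lists)
  have "bij_betw (\<lambda>(x, xs). x # xs) (S \<times> lists S) (lists S - {[]})"
    by (rule bij_betw_byWitness[where f' = "\<lambda>xs. (hd xs, tl xs)"])
      (auto simp: neq_Nil_conv)
  then have "gf ?w (lists S - {[]}) = gf (\<lambda>(x, xs). f x + ?w xs) (S \<times> lists S)"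
    by (rule gf_bij) auto
  also have "\<dots> = gf f S * gf ?w (lists S)"
    by (rule gf_Times[OF fin finl])
  finally have step: "gf ?w (lists S - {[]}) = gf f S * gf ?w (lists S)" .
  have "gf ?w (lists S) = gf ?w {[]} + gf ?w (lists S - {[]})"
  proof (subst split, rule gf_Un)
    show "finite (level ?w (lists S - {[]}) n)" for n
      by (rule finite_subset[OF _ finl[of n]]) (auto simp: level_def)
  qed (auto simp: level_def)
  also have "gf ?w {[]} = 1"
    by (subst gf_weight_zero) auto
  finally have "gf ?w (lists S) = 1 + gf f S * gf ?w (lists S)"
    by (simp add: step)
  then show ?thesis
    by (simp add: algebra_simps)
qed

section \<open>First-return decomposition of Dyck paths\<close>

primrec step_height :: "cstep \<Rightarrow> int" where
  "step_height (Up c) = 1"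
| "step_height Down = -1"

definition height :: "cstep list \<Rightarrow> int" where
  "height P = (\<Sum>s\<leftarrow>P. step_height s)"

lemma height_simps [simp]:
  "height [] = 0"
  "height (s # P) = step_height s + height P"
  "height (P @ Q) = height P + height Q"
  by (simp_all add: height_def)

definition balanced :: "cstep list \<Rightarrow> bool" where
  "balanced P \<longleftrightarrow> height P = 0 \<and> (\<forall>m. 0 \<le> height (take m P))"

lemma endpoint_uncolor: "endpoint (map uncolor P) = (int (length P), height P)"
proof (induction P)
  case (Cons s P)
  then show ?case
    by (cases s) (auto simp: endpoint_def)
qed (simp add: endpoint_def zero_prod_def)

lemma dyck_path_uncolor: "dyck_path n (map uncolor P) \<longleftrightarrow> balanced P \<and> length P = 2 * n"
proof -
  have "(\<forall>m\<le>length P. 0 \<le> height (take m P)) \<longleftrightarrow> (\<forall>m. 0 \<le> height (take m P))"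
    by (metis nat_le_linear take_all_iff order_refl)
  then show ?thesis
    by (auto simp: dyck_path_def balanced_def endpoint_uncolor take_map)
qed

lemma balanced_Nil [simp]: "balanced []"
  by (simp add: balanced_def)

lemma balanced_append: "balanced P \<Longrightarrow> balanced Q \<Longrightarrow> balanced (P @ Q)"
  by (simp add: balanced_def)

lemma balanced_hd: "balanced (s # P) \<Longrightarrow> s \<noteq> Down"
  unfolding balanced_def by (auto dest: spec[of _ "Suc 0"])

text \<open>A last up step would leave the preceding prefix at height -1. Hence a cut between
  segments never separates an up step from the step that decides its coloring.\<close>

lemma balanced_last:
  assumes "balanced P" "P \<noteq> []"
  shows "last P = Down"
proof -
  have "0 \<le> height (butlast P)"
    using assms by (simp add: balanced_def butlast_conv_take)
  moreover have "height (butlast P) + step_height (last P) = 0"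
    using assms append_butlast_last_id[of P] height_simps(3)[of "butlast P" "[last P]"]
    by (simp add: balanced_def)
  ultimately show ?thesis
    by (cases "last P") auto
qed

lemma balanced_first_return: "balanced Q \<Longrightarrow> balanced R \<Longrightarrow> balanced (Up c # Q @ Down # R)"
  by (auto simp: balanced_def take_Cons' algebra_simps add_increasing)

lemma balanced_first_return_exists:
  assumes "balanced P" "P \<noteq> []"
  obtains c Q R where "P = Up c # Q @ Down # R" "balanced Q" "balanced R"
proof -
  obtain c P' where P: "P = Up c # P'"
    using assms by (metis balanced_hd cstep.exhaust list.exhaust)
  have low: "-1 \<le> height (take m P')" for m
    using assms(1) P unfolding balanced_def by (auto dest: spec[of _ "Suc m"])
  have total: "height P' = -1"
    using assms(1) P by (simp add: balanced_def)
  \<comment> \<open>The first time \<open>P'\<close> reaches -1, that is, the first return of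
    \<open>P\<close> to the axis.\<close>
  define m where "m = (LEAST m. height (take m P') = -1)"
  have m: "height (take m P') = -1"
    unfolding m_def by (rule LeastI[of _ "length P'"]) (simp add: total)
  have above: "0 \<le> height (take l P')" if "l < m" for l
    using low[of l] not_less_Least[of l "\<lambda>m. height (take m P') = -1"] that
    unfolding m_def by fastforce
  obtain j where j: "m = Suc j"
    using m by (cases m) auto
  \<comment> \<open>If \<open>P'\<close> had at most \<open>j\<close> steps, its prefixes of lengths
    \<open>j\<close> and \<open>m\<close> would coincide, although only the second has negative
    height.\<close>
  have jlen: "j < length P'"
  proof (rule ccontr)
    assume "\<not> j < length P'"
    then have "height (take j P') = height (take m P')"
      by (simp add: j)
    with above[of j] m show False
      by (simp add: j)
  qed
  then have "height (take j P') + step_height (P' ! j) = -1"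
    using m by (simp add: j take_Suc_conv_app_nth)
  with above[of j] have down: "P' ! j = Down" and hj: "height (take j P') = 0"
    by (cases "P' ! j"; simp add: j)+
  define Q R where "Q = take j P'" and "R = drop (Suc j) P'"
  have P': "P' = Q @ Down # R"
    using jlen down by (metis Q_def R_def id_take_nth_drop)
  have "height Q = 0"
    by (simp add: Q_def hj)
  show thesis
  proof
    show "P = Up c # Q @ Down # R"
      by (simp add: P P')
    show "balanced Q"
      unfolding balanced_def
    proof (intro conjI allI)
      \<comment> \<open>Prefixes of \<open>Q\<close> are prefixes of \<open>P'\<close> of length at
        most \<open>j\<close>, hence before the first visit to -1.\<close>
      show "0 \<le> height (take l Q)" for l
        using above[of "min l j"] by (simp add: Q_def j)
    qed fact
    show "balanced R"
      unfolding balanced_def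
    proof (intro conjI allI)
      show "height R = 0"
        using total \<open>height Q = 0\<close> by (simp add: P')
      show "0 \<le> height (take l R)" for l
      proof -
        \<comment> \<open>The part \<open>Q @ [Down]\<close> has height -1, so the bound -1 on
          prefixes of \<open>P'\<close> becomes 0 on prefixes of \<open>R\<close>.\<close>
        have "take (length Q + Suc l) P' = Q @ Down # take l R"
          by (simp add: P')
        then show ?thesis
          using low[of "length Q + Suc l"] \<open>height Q = 0\<close> by simp
      qed
    qed
  qed
qed

text \<open>If \<open>Q'\<close> were longer than \<open>Q\<close>, then \<open>Q @ [Down]\<close>,
  of height -1, would be a prefix of the balanced \<open>Q'\<close>.\<close>

lemma balanced_no_longer_return:
  assumes "balanced Q" "balanced Q'" "Q @ Down # R = Q' @ Down # R'"
  shows "length Q' \<le> length Q"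
proof (rule ccontr)
  assume "\<not> length Q' \<le> length Q"
  then have "take (Suc (length Q)) Q' = take (Suc (length Q)) (Q @ Down # R)"
    using assms(3) by simp
  then have "height (take (Suc (length Q)) Q') = -1"
    using assms(1) by (simp add: balanced_def)
  with assms(2) show False
    unfolding balanced_def by (metis neg_0_le_iff_le not_one_le_zero)
qed

lemma balanced_first_return_unique:
  assumes "balanced Q" "balanced Q'" "Q @ Down # R = Q' @ Down # R'"
  shows "Q = Q' \<and> R = R'"
proof -
  have "length Q = length Q'"
    using assms balanced_no_longer_return[of Q Q' R R'] balanced_no_longer_return[of Q' Q R' R]
    by simp
  with assms(3) show ?thesis
    by simp
qed

section \<open>Colored Dyck paths\<close>

text \<open>A test of the color of an up step against the path after it, suited to recursion. An
  empty remainder falls under the second clause, matching the failure of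
  \<open>Suc p < length P\<close> in \<open>k_dyck_path\<close>.\<close>

fun admissible :: "nat \<Rightarrow> nat option \<Rightarrow> cstep list \<Rightarrow> bool" where
  "admissible k c (Down # _) \<longleftrightarrow> c = None"
| "admissible k c _ \<longleftrightarrow> c \<in> Some ` {1..k}"

fun properly_colored :: "nat \<Rightarrow> cstep list \<Rightarrow> bool" where
  "properly_colored k [] \<longleftrightarrow> True"
| "properly_colored k (Down # P) \<longleftrightarrow> properly_colored k P"
| "properly_colored k (Up c # P) \<longleftrightarrow> admissible k c P \<and> properly_colored k P"

lemma admissible_alt:
  "admissible k c P \<longleftrightarrow> (if P \<noteq> [] \<and> P ! 0 = Down then c = None else c \<in> Some ` {1..k})"
  by (cases "(k, c, P)" rule: admissible.cases) auto

text \<open>Separates the head of a path (position 0) from the positions of its tail in the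
  induction below.\<close>

lemma all_nat_Suc_iff: "(\<forall>n. Q n) \<longleftrightarrow> Q 0 \<and> (\<forall>n. Q (Suc n))"
  by (metis not0_implies_Suc)

lemma properly_colored_iff:
  "properly_colored k P \<longleftrightarrow>
     (\<forall>p c. p < length P \<and> P ! p = Up c \<longrightarrow>
        (if Suc p < length P \<and> P ! Suc p = Down then c = None else c \<in> Some ` {1..k}))"
proof (induction P rule: properly_colored.induct)
  case (2 k P)
  then show ?case
    by (subst all_nat_Suc_iff) simp
next
  case (3 k c P)
  then show ?case
    by (subst all_nat_Suc_iff) (simp add: admissible_alt)
qed simp

text \<open>Only an up step at the end of \<open>P\<close> could have its constraint changed by
  appending \<open>Q\<close>.\<close>

lemma properly_colored_append:
  assumes "P = [] \<or> last P = Down"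
  shows "properly_colored k (P @ Q) \<longleftrightarrow> properly_colored k P \<and> properly_colored k Q"
  using assms
proof (induction k P rule: properly_colored.induct)
  case (3 k c P)
  then have "P \<noteq> []" "last P = Down"
    by (auto split: if_splits)
  with 3 show ?case
    by (simp add: admissible_alt nth_append)
qed (auto split: if_splits)

definition kdyck :: "nat \<Rightarrow> cstep list set" where
  "kdyck k = {P. balanced P \<and> properly_colored k P}"

lemma k_dyck_path_iff: "k_dyck_path k n P \<longleftrightarrow> P \<in> kdyck k \<and> length P = 2 * n"
  by (auto simp: k_dyck_path_def dyck_path_uncolor kdyck_def properly_colored_iff)

lemma kdyck_Nil [simp]: "[] \<in> kdyck k"
  by (simp add: kdyck_def)

lemma kdyck_append: "P \<in> kdyck k \<Longrightarrow> Q \<in> kdyck k \<Longrightarrow> P @ Q \<in> kdyck k"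
  using balanced_last[of P] properly_colored_append[of P k Q]
  by (auto simp: kdyck_def balanced_append)

lemma kdyck_concat: "set Ps \<subseteq> kdyck k \<Longrightarrow> concat Ps \<in> kdyck k"
  by (induction Ps) (auto intro: kdyck_append)

text \<open>Each step changes length and height by odd amounts, so their parities agree. This
  supplies the semilength demanded by \<open>k_dyck_path\<close>.\<close>

lemma kdyck_even_length: "P \<in> kdyck k \<Longrightarrow> even (length P)"
proof -
  have "even (int (length P) - height P)"
  proof (induction P)
    case (Cons s P)
    then show ?case by (cases s) auto
  qed simp
  then show "P \<in> kdyck k \<Longrightarrow> even (length P)"
    by (simp add: kdyck_def balanced_def)
qed

text \<open>A nonempty balanced \<open>Q\<close> begins with an up step, so the initial up step is
  followed by a down step exactly when \<open>Q\<close> is empty. All other constraints live inside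
  \<open>Q\<close> or inside \<open>R\<close>.\<close>

lemma kdyck_first_return:
  assumes "balanced Q" "balanced R"
  shows "Up c # Q @ Down # R \<in> kdyck k \<longleftrightarrow>
     Q \<in> kdyck k \<and> R \<in> kdyck k \<and> (if Q = [] then c = None else c \<in> Some ` {1..k})"
proof -
  have "properly_colored k (Q @ Down # R) \<longleftrightarrow> properly_colored k Q \<and> properly_colored k R"
    using assms balanced_last[of Q] by (subst properly_colored_append) auto
  moreover have "admissible k c (Q @ Down # R) \<longleftrightarrow> (if Q = [] then c = None else c \<in> Some ` {1..k})"
    using assms balanced_hd by (cases Q) (auto simp: admissible_alt)
  ultimately show ?thesis
    using assms by (auto simp: kdyck_def balanced_first_return)
qed

lemma kdyck_elements: "P \<in> kdyck k \<Longrightarrow> set P \<subseteq> insert Down (Up ` insert None (Some ` {1..k}))"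
proof -
  have "properly_colored k P \<Longrightarrow> set P \<subseteq> insert Down (Up ` insert None (Some ` {1..k}))"
    by (induction k P rule: properly_colored.induct) (auto simp: admissible_alt split: if_splits)
  then show "P \<in> kdyck k \<Longrightarrow> set P \<subseteq> insert Down (Up ` insert None (Some ` {1..k}))"
    by (simp add: kdyck_def)
qed

section \<open>The functional equation for colored Dyck paths\<close>

lemma finite_level_kdyck:
  assumes "S \<subseteq> kdyck k"
  shows "finite (level length S n)"
proof (rule finite_subset)
  show "level length S n
      \<subseteq> {P. set P \<subseteq> insert Down (Up ` insert None (Some ` {1..k})) \<and> length P = n}"
    using assms kdyck_elements unfolding level_def by blast
qed (simp add: finite_lists_length_eq)

lemma gf_kdyck: "gf length (kdyck k) = 1 + gf length (kdyck k - {[]})"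
proof -
  have "gf length ({[]} \<union> (kdyck k - {[]})) = gf length {[] :: cstep list} + gf length (kdyck k - {[]})"
    by (rule gf_Un) (auto intro!: finite_level_kdyck[of _ k])
  moreover have "gf length {[] :: cstep list} = 1"
    by (subst gf_weight_zero) auto
  moreover have "{[]} \<union> (kdyck k - {[]}) = kdyck k"
    by auto
  ultimately show ?thesis
    by simp
qed

lemma gf_kdyck_nonempty:
  fixes k :: nat
  defines "N \<equiv> gf length (kdyck k - {[]})"
  shows "N = fps_X ^ 2 * (1 + N) * (1 + of_nat k * N)"
proof -
  let ?K = "kdyck k" and ?w = "\<lambda>(c :: nat option, Q, R). length (Q :: cstep list) + length (R :: cstep list)"
  \<comment> \<open>\<open>S0\<close> collects the paths starting with a peak, whose up step is
    uncolored. \<open>S1\<close> collects those with nonempty \<open>Q\<close>, where the first up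
    step has \<open>k\<close> possible colors.\<close>
  define S0 where "S0 = {None :: nat option} \<times> {[] :: cstep list} \<times> ?K"
  define S1 where "S1 = (Some ` {1..k}) \<times> (?K - {[]}) \<times> ?K"
  let ?v = "\<lambda>(Q :: cstep list, R :: cstep list). length Q + length R"
  \<comment> \<open>Giving the color weight 0 turns the weight on triples into an iterated sum, the
    form that the product rule expects.\<close>
  have w: "?w = (\<lambda>(c, p). 0 + ?v p)"
    by auto
  have finc: "finite (level (\<lambda>_. 0) C n)" if "finite C" for C :: "nat option set" and n
    using that by (simp add: level_def)
  have finl: "finite (level length T n)" if "T \<subseteq> ?K" for T n
    using that by (rule finite_level_kdyck)
  have finv: "finite (level ?v (T \<times> ?K) n)" if "T \<subseteq> ?K" for T n
    using that by (intro finite_level_Times finl) auto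
  have gfS: "gf ?w (C \<times> T \<times> ?K) = of_nat (card C) * (gf length T * gf length ?K)"
    if "finite C" "T \<subseteq> ?K" for C T
  proof -
    have "gf ?w (C \<times> T \<times> ?K) = gf (\<lambda>_. 0) C * gf ?v (T \<times> ?K)"
      unfolding w using that by (intro gf_Times finc finv)
    also have "gf ?v (T \<times> ?K) = gf length T * gf length ?K"
      using that by (intro gf_Times finl) auto
    finally show ?thesis
      by (simp add: gf_weight_zero)
  qed
  have finS: "finite (level ?w (C \<times> T \<times> ?K) n)" if "finite C" "T \<subseteq> ?K" for C T n
    unfolding w using that by (intro finite_level_Times finc finv)
  have "bij_betw (\<lambda>(c, Q, R). Up c # Q @ Down # R) (S0 \<union> S1) (?K - {[]})"
  proof (rule bij_betw_imageI)
    show "inj_on (\<lambda>(c, Q, R). Up c # Q @ Down # R) (S0 \<union> S1)"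
      by (rule inj_onI)
        (auto simp: S0_def S1_def kdyck_def dest!: balanced_first_return_unique[rotated 2])
    show "(\<lambda>(c, Q, R). Up c # Q @ Down # R) ` (S0 \<union> S1) = ?K - {[]}" (is "?h ` _ = _")
    proof (intro equalityI subsetI)
      fix P assume "P \<in> ?h ` (S0 \<union> S1)"
      then obtain c Q R where "P = Up c # Q @ Down # R" "(c, Q, R) \<in> S0 \<union> S1"
        by auto
      moreover from this have "balanced Q" "balanced R"
        by (auto simp: S0_def S1_def kdyck_def)
      ultimately show "P \<in> ?K - {[]}"
        using kdyck_first_return[of Q R c k] by (auto simp: S0_def S1_def)
    next
      fix P assume P: "P \<in> ?K - {[]}"
      then obtain c Q R where dec: "P = Up c # Q @ Down # R" "balanced Q" "balanced R"
        using balanced_first_return_exists[of P] by (auto simp: kdyck_def)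
      then have "(c, Q, R) \<in> S0 \<union> S1"
        using P kdyck_first_return[of Q R c k] by (auto simp: S0_def S1_def split: if_splits)
      with dec show "P \<in> ?h ` (S0 \<union> S1)"
        by force
    qed
  qed
  then have "N = fps_X ^ 2 * gf ?w (S0 \<union> S1)"
    unfolding N_def by (rule gf_bij_shift) auto
  also have "gf ?w (S0 \<union> S1) = gf ?w S0 + gf ?w S1"
    by (rule gf_Un) (auto simp: S0_def S1_def intro!: finS)
  also have "gf ?w S0 = 1 + N"
  proof -
    have "gf length {[] :: cstep list} = 1"
      by (subst gf_weight_zero) auto
    then show ?thesis
      unfolding S0_def by (subst gfS) (auto simp: gf_kdyck N_def)
  qed
  also have "gf ?w S1 = of_nat k * (N * (1 + N))"
    unfolding S1_def by (subst gfS) (auto simp: card_image gf_kdyck N_def)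
  finally show ?thesis
    by (simp add: algebra_simps)
qed

section \<open>Colored compositions\<close>

definition colored_lists :: "nat \<Rightarrow> nat set \<Rightarrow> (cstep list \<times> nat) list set" where
  "colored_lists k C = lists ((kdyck k - {[]}) \<times> C)"

definition total_length :: "(cstep list \<times> nat) list \<Rightarrow> nat" where
  "total_length zs = (\<Sum>z\<leftarrow>zs. length (fst z))"

lemma segments_levels:
  fixes C :: "nat set"
  assumes "finite C"
  shows "gf (\<lambda>z. length (fst z)) ((kdyck k - {[]}) \<times> C) = of_nat (card C) * gf length (kdyck k - {[]})"
    and "finite (level (\<lambda>z. length (fst z)) ((kdyck k - {[]}) \<times> C) n)"
proof -
  have w: "(\<lambda>z :: cstep list \<times> nat. length (fst z)) = (\<lambda>(P, c). length P + 0)"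
    by auto
  have fin: "finite (level length (kdyck k - {[]}) n)" "finite (level (\<lambda>_. 0) C n)" for n
    using assms by (auto simp: level_def[of "\<lambda>_. 0"] intro: finite_level_kdyck)
  show "gf (\<lambda>z. length (fst z)) ((kdyck k - {[]}) \<times> C) = of_nat (card C) * gf length (kdyck k - {[]})"
    unfolding w by (rule trans[OF gf_Times[OF fin]]) (simp add: gf_weight_zero mult.commute)
  show "finite (level (\<lambda>z. length (fst z)) ((kdyck k - {[]}) \<times> C) n)"
    unfolding w by (rule finite_level_Times) (simp_all add: fin)
qed

lemma finite_level_colored_lists:
  assumes "finite C"
  shows "finite (level total_length (colored_lists k C) n)"
  unfolding total_length_def colored_lists_def
  using assms by (intro finite_level_lists segments_levels) auto

lemma gf_colored_lists:
  assumes "finite C"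
  shows "gf total_length (colored_lists k C) * (1 - of_nat (card C) * gf length (kdyck k - {[]})) = 1"
proof -
  have "gf total_length (colored_lists k C)
      * (1 - gf (\<lambda>z. length (fst z)) ((kdyck k - {[]}) \<times> C)) = 1"
    unfolding total_length_def colored_lists_def
    using assms by (intro gf_lists segments_levels) auto
  then show ?thesis
    using assms by (simp add: segments_levels)
qed

text \<open>The path is recovered as \<open>concat Ps\<close>, which is again a
  \<open>k\<close>-Dyck path, so only its length remains to be prescribed. The use of color 1
  guarantees a segment, and parity supplies the semilength of each segment.\<close>

lemma colored_compositions_iff:
  "(Ps, cs) \<in> colored_compositions k t n \<longleftrightarrow>
     set Ps \<subseteq> kdyck k - {[]} \<and> length (concat Ps) = 2 * n \<and> feasible_coloring t Ps cs"
proof -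
  have "(\<exists>m. k_dyck_path k m Q) \<longleftrightarrow> Q \<in> kdyck k" for Q
    using kdyck_even_length[of Q k] by (auto simp: k_dyck_path_iff elim: evenE)
  moreover have "concat Ps \<in> kdyck k" if "set Ps \<subseteq> kdyck k - {[]}"
    using that by (auto intro: kdyck_concat)
  moreover have "Ps \<noteq> []" if "feasible_coloring t Ps cs"
    using that by (auto simp: feasible_coloring_def)
  ultimately show ?thesis
    by (auto simp: colored_compositions_def composition_def k_dyck_path_iff)
qed

text \<open>Zipping loses nothing because feasibility forces equal lengths. Removing the lists
  colored from \<open>{2..t}\<close> leaves exactly those in which color 1 occurs.\<close>

lemma bij_colored_compositions:
  "bij_betw (\<lambda>(Ps, cs). zip Ps cs) (colored_compositions k t n)
     (level total_length (colored_lists k {1..t}) (2 * n)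
      - level total_length (colored_lists k {2..t}) (2 * n))"
    (is "bij_betw ?z ?A ?B")
proof (rule bij_betw_byWitness[where f' = "\<lambda>zs. (map fst zs, map snd zs)"])
  have tot: "total_length zs = length (concat (map fst zs))" for zs
    by (simp add: total_length_def length_concat comp_def)
  have mem: "zs \<in> colored_lists k C \<longleftrightarrow> set (map fst zs) \<subseteq> kdyck k - {[]} \<and> set (map snd zs) \<subseteq> C" for zs C
    by (auto simp: colored_lists_def in_lists_conv_set)
  have colors: "{2..t} = {1..t} - {1}"
    by auto
  have B: "zs \<in> ?B \<longleftrightarrow> (map fst zs, map snd zs) \<in> ?A" for zs
    unfolding colors level_def Diff_iff mem_Collect_eq tot mem colored_compositions_iff
      feasible_coloring_def length_map
    by blast
  have len: "length cs = length Ps" if "(Ps, cs) \<in> ?A" for Ps cs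
    using that by (simp add: colored_compositions_iff feasible_coloring_def)
  show "\<forall>a\<in>?A. (map fst (?z a), map snd (?z a)) = a"
    using len by auto
  show "\<forall>zs\<in>?B. ?z (map fst zs, map snd zs) = zs"
    by (simp add: zip_map_fst_snd)
  show "?z ` ?A \<subseteq> ?B"
    using len by (auto simp only: B split_beta image_subset_iff) simp
  show "(\<lambda>zs. (map fst zs, map snd zs)) ` ?B \<subseteq> ?A"
    using B by blast
qed

section \<open>Elimination and extraction of coefficients\<close>

text \<open>Here \<open>s\<close> stands for \<open>t - 1\<close> and \<open>x\<close> for the
  square of the variable. With \<open>E\<close> the product of the two denominators,
  \<open>(A - B) * E = N\<close>, and \<open>E\<close> can be cancelled since \<open>A * B\<close>
  is its inverse.\<close>

lemma generating_function_identity: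
  fixes N A B x s :: "'a :: comm_ring_1"
  assumes N: "N = x * (1 + N) * (1 + (s + 1) * s * N)"
    and A: "A * (1 - (s + 1) * N) = 1" and B: "B * (1 - s * N) = 1"
  shows "A - B = x * (1 + (s + 1) * (s + 2) * (A - B))"
proof -
  define E where "E = (1 - (s + 1) * N) * (1 - s * N)"
  have ABE: "A * B * E = 1"
    using A B unfolding E_def by (metis mult.assoc mult.commute mult_1)
  have "(A - B) * E = A * (1 - (s + 1) * N) * (1 - s * N) - B * (1 - s * N) * (1 - (s + 1) * N)"
    unfolding E_def by (simp add: algebra_simps)
  also have "\<dots> = N"
    unfolding A B by (simp add: algebra_simps)
  finally have WE: "(A - B) * E = N" .
  \<comment> \<open>The choice \<open>k = (s + 1) * s\<close> enters here: adding
    \<open>(s + 1) * (s + 2) * N\<close> to \<open>E\<close> gives the two factors in the equation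
    for \<open>N\<close>.\<close>
  have "E + (s + 1) * (s + 2) * N = (1 + N) * (1 + (s + 1) * s * N)"
    unfolding E_def by (simp add: algebra_simps)
  then have "x * (E + (s + 1) * (s + 2) * N) = N"
    using N by (metis mult.assoc)
  moreover have "x * (1 + (s + 1) * (s + 2) * (A - B)) * E
      = x * (E + (s + 1) * (s + 2) * ((A - B) * E))"
    by (simp add: algebra_simps)
  ultimately have "(A - B) * E = x * (1 + (s + 1) * (s + 2) * (A - B)) * E"
    by (simp only: WE)
  then have "(A - B) * (A * B * E) = x * (1 + (s + 1) * (s + 2) * (A - B)) * (A * B * E)"
    by (metis mult.assoc mult.commute)
  then show ?thesis
    by (simp only: ABE mult_1_right)
qed

lemma card_colored_compositions:
  "card (colored_compositions ((Suc s)\<^sup>2 - Suc s) (Suc s) (Suc n)) = ((Suc s)\<^sup>2 + Suc s) ^ n"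
proof -
  define k where "k = (Suc s)\<^sup>2 - Suc s"
  define N where "N = gf length (kdyck k - {[]})"
  define A where "A = gf total_length (colored_lists k {1..Suc s})"
  define B where "B = gf total_length (colored_lists k {2..Suc s})"
  have k: "of_nat k = ((of_nat s + 1) * of_nat s :: int fps)"
    by (simp add: k_def power2_eq_square algebra_simps)
  have "N = fps_X ^ 2 * (1 + N) * (1 + (of_nat s + 1) * of_nat s * N)"
    using gf_kdyck_nonempty[of k] by (simp add: N_def k)
  moreover have "A * (1 - (of_nat s + 1) * N) = 1"
    using gf_colored_lists[of "{1..Suc s}" k] by (simp add: A_def N_def add.commute)
  moreover have "B * (1 - of_nat s * N) = 1"
    using gf_colored_lists[of "{2..Suc s}" k] by (simp add: B_def N_def)
  ultimately have "A - B = fps_X ^ 2 * (1 + (of_nat s + 1) * (of_nat s + 2) * (A - B))"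
    by (rule generating_function_identity)
  also have "(of_nat s + 1) * (of_nat s + 2) = fps_const (int ((Suc s)\<^sup>2 + Suc s))"
    unfolding fps_of_nat by (simp add: power2_eq_square algebra_simps)
  finally have W: "A - B = fps_X ^ 2 * (1 + fps_const (int ((Suc s)\<^sup>2 + Suc s)) * (A - B))" .
  have W0: "(A - B) $ 0 = 0"
    by (subst W) (simp add: fps_X_power_mult_nth)
  \<comment> \<open>Comparing coefficients in \<open>W\<close> gives a first-order recursion along
    even exponents. The summand 1 contributes only at exponent 2, where \<open>W0\<close> supplies
    the initial value.\<close>
  have Wstep: "(A - B) $ (2 * Suc n) =
      (if n = 0 then 1 else 0) + int ((Suc s)\<^sup>2 + Suc s) * (A - B) $ (2 * n)" for n
    by (subst W) (simp add: fps_X_power_mult_nth del: of_nat_add)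
  have W2: "(A - B) $ (2 * Suc n) = int ((Suc s)\<^sup>2 + Suc s) ^ n" for n
  proof (induction n)
    case 0
    show ?case using Wstep[of 0] W0 by simp
  next
    case (Suc n)
    show ?case unfolding Wstep[of "Suc n"] Suc by simp
  qed
  let ?LA = "level total_length (colored_lists k {1..Suc s}) (2 * Suc n)"
  let ?LB = "level total_length (colored_lists k {2..Suc s}) (2 * Suc n)"
  \<comment> \<open>Inclusion and finiteness turn the size of the difference into a difference of
    coefficients.\<close>
  have "?LB \<subseteq> ?LA"
    unfolding level_def colored_lists_def in_lists_conv_set by fastforce
  moreover have "finite ?LA"
    by (rule finite_level_colored_lists) simp
  ultimately have "int (card (?LA - ?LB)) = (A - B) $ (2 * Suc n)"
    by (simp add: A_def B_def card_Diff_subset finite_subset of_nat_diff card_mono)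
  also have "\<dots> = int (((Suc s)\<^sup>2 + Suc s) ^ n)"
    unfolding W2 by simp
  finally have "card (?LA - ?LB) = ((Suc s)\<^sup>2 + Suc s) ^ n"
    by (simp only: of_nat_eq_iff)
  then show ?thesis
    using bij_betw_same_card[OF bij_colored_compositions[of k "Suc s" "Suc n"]]
    by (simp add: k_def)
qed

theorem theorem6p3:
  fixes t i :: nat and A :: "'a set"
  assumes "t \<ge> 1" and "i \<ge> 1"
    and "finite A" and "card A = t^2 + t"
  shows "\<exists>f. bij_betw f (colored_compositions (t^2 - t) t i)
                        {w :: 'a list. set w \<subseteq> A \<and> length w = i - 1}"
proof -
  obtain s n where [simp]: "t = Suc s" "i = Suc n"
    using assms(1,2) by (metis One_nat_def Suc_le_D)
  have card: "card (colored_compositions (t\<^sup>2 - t) t i) = (t\<^sup>2 + t) ^ (i - 1)"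
    using card_colored_compositions[of s n] by simp
  \<comment> \<open>Infinite sets have \<open>card\<close> 0, so a positive count, due to
    \<open>t\<close> being positive, proves finiteness.\<close>
  then have "0 < card (colored_compositions (t\<^sup>2 - t) t i)"
    by simp
  then have "finite (colored_compositions (t\<^sup>2 - t) t i)"
    by (rule card_ge_0_finite)
  moreover have "finite {w :: 'a list. set w \<subseteq> A \<and> length w = i - 1}"
    using assms(3) by (rule finite_lists_length_eq)
  moreover have "card (colored_compositions (t\<^sup>2 - t) t i) = card {w :: 'a list. set w \<subseteq> A \<and> length w = i - 1}"
    using card card_lists_length_eq[OF assms(3), of "i - 1"] assms(4) by simp
  ultimately show ?thesis
    by (rule finite_same_card_bij)
qed

end
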